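(* There exists an infinite family of $4$-regular planar graphs each of which admits both a bendless planar smooth orthogonal drawing and a bendless planar octilinear drawing.
   Context: All drawings are planar: vertices are distinct points in the plane and edges are drawn without crossings. In a smooth orthogonal drawing every edge is a sequence of segments, each of which is either an axis-aligned straight-line segment or a circular arc (quarter, half or three-quarter arc) whose tangents at its endpoints are axis-aligned, with consecutive segments sharing a common tangent; each edge leaves/enters a vertex in one of the four axis-aligned directions (ports), and no two edges incident to a vertex use the same port. In an octilinear drawing every edge is a sequence of straight-line segments, each horizontal, vertical, or of slope $\pm 1$; each vertex has eight ports (the eight corresponding directions), and no two edges incident to a vertex use the same port. A drawing is bendless if every edge consists of exactly one segment. *)

theory Defs
  imports "HOL-Complex_Analysis.Complex_Analysis"
begin

section \<open>Graphs\<close>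

type_synonym 'a graph = "'a set \<times> 'a set set"

abbreviation verts :: "'a graph \<Rightarrow> 'a set" where "verts \<equiv> fst"
abbreviation edges :: "'a graph \<Rightarrow> 'a set set" where "edges \<equiv> snd"

definition simple_graph :: "'a graph \<Rightarrow> bool" where
  "simple_graph G \<longleftrightarrow> finite (verts G) \<and> (\<forall>e\<in>edges G. e \<subseteq> verts G \<and> card e = 2)"

definition degree_of :: "'a graph \<Rightarrow> 'a \<Rightarrow> nat" where
  "degree_of G v = card {e \<in> edges G. v \<in> e}"

definition regular_graph :: "nat \<Rightarrow> 'a graph \<Rightarrow> bool" where
  "regular_graph k G \<longleftrightarrow> (\<forall>v\<in>verts G. degree_of G v = k)"

definition isomorphic_graphs :: "'a graph \<Rightarrow> 'b graph \<Rightarrow> bool" where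
  "isomorphic_graphs G H \<longleftrightarrow>
     (\<exists>f. bij_betw f (verts G) (verts H) \<and> (`) f ` edges G = edges H)"


section \<open>Planar drawings\<close>

text \<open>The plane is \<^typ>\<open>complex\<close>. A drawing places the vertices by \<open>p\<close> and the edges by \<open>c\<close>.\<close>

definition planar_drawing ::
    "'a graph \<Rightarrow> ('a \<Rightarrow> complex) \<Rightarrow> ('a set \<Rightarrow> real \<Rightarrow> complex) \<Rightarrow> bool" where
  "planar_drawing G p c \<longleftrightarrow>
     inj_on p (verts G) \<and>
     (\<forall>e\<in>edges G. arc (c e) \<and> {pathstart (c e), pathfinish (c e)} = p ` e \<and>
                  path_image (c e) \<inter> p ` verts G = p ` e) \<and>
     (\<forall>e\<in>edges G. \<forall>f\<in>edges G. e \<noteq> f \<longrightarrow> path_image (c e) \<inter> path_image (c f) \<subseteq> p ` (e \<inter> f))"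

definition planar_graph :: "'a graph \<Rightarrow> bool" where
  "planar_graph G \<longleftrightarrow> (\<exists>p c. planar_drawing G p c)"


section \<open>Segments\<close>

text \<open>Unit tangent vectors at the two endpoints of a path, in the direction of traversal.\<close>

definition start_dir :: "(real \<Rightarrow> complex) \<Rightarrow> complex" where
  "start_dir g = sgn (vector_derivative g (at 0 within {0..1}))"

definition end_dir :: "(real \<Rightarrow> complex) \<Rightarrow> complex" where
  "end_dir g = sgn (vector_derivative g (at 1 within {0..1}))"

definition axis_aligned :: "complex \<Rightarrow> bool" where
  "axis_aligned d \<longleftrightarrow> Re d = 0 \<or> Im d = 0"

definition diagonal :: "complex \<Rightarrow> bool" where
  "diagonal d \<longleftrightarrow> Im d = Re d \<or> Im d = - Re d"

definition axis_aligned_segment :: "(real \<Rightarrow> complex) \<Rightarrow> bool" where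
  "axis_aligned_segment g \<longleftrightarrow> (\<exists>a b. a \<noteq> b \<and> axis_aligned (b - a) \<and> g = linepath a b)"

definition diagonal_segment :: "(real \<Rightarrow> complex) \<Rightarrow> bool" where
  "diagonal_segment g \<longleftrightarrow> (\<exists>a b. a \<noteq> b \<and> diagonal (b - a) \<and> g = linepath a b)"

text \<open>Quarter, half and three-quarter arcs, traversed in either orientation.\<close>

definition axis_aligned_arc :: "(real \<Rightarrow> complex) \<Rightarrow> bool" where
  "axis_aligned_arc g \<longleftrightarrow>
     (\<exists>z r s t. r > 0 \<and> \<bar>t - s\<bar> \<in> {pi / 2, pi, 3 * pi / 2} \<and> g = part_circlepath z r s t) \<and>
     axis_aligned (start_dir g) \<and> axis_aligned (end_dir g)"


section \<open>Drawings by sequences of segments\<close>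

fun join_segments :: "(real \<Rightarrow> complex) list \<Rightarrow> real \<Rightarrow> complex" where
  "join_segments [] = (\<lambda>_. 0)"
| "join_segments [g] = g"
| "join_segments (g # h # gs) = g +++ join_segments (h # gs)"

definition smooth_orthogonal_edge :: "(real \<Rightarrow> complex) list \<Rightarrow> bool" where
  "smooth_orthogonal_edge gs \<longleftrightarrow>
     gs \<noteq> [] \<and>
     (\<forall>g\<in>set gs. axis_aligned_segment g \<or> axis_aligned_arc g) \<and>
     successively (\<lambda>g h. pathfinish g = pathstart h \<and> end_dir g = start_dir h) gs"

definition octilinear_edge :: "(real \<Rightarrow> complex) list \<Rightarrow> bool" where
  "octilinear_edge gs \<longleftrightarrow>
     gs \<noteq> [] \<and>
     (\<forall>g\<in>set gs. axis_aligned_segment g \<or> diagonal_segment g) \<and>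
     successively (\<lambda>g h. pathfinish g = pathstart h) gs"

text \<open>The direction in which the edge drawn as \<open>gs\<close> leaves its endpoint \<open>x\<close>.\<close>

definition port :: "(real \<Rightarrow> complex) list \<Rightarrow> complex \<Rightarrow> complex" where
  "port gs x = (if pathstart (hd gs) = x then start_dir (hd gs) else - end_dir (last gs))"

definition respects_ports ::
    "complex set \<Rightarrow> 'a graph \<Rightarrow> ('a \<Rightarrow> complex) \<Rightarrow> ('a set \<Rightarrow> (real \<Rightarrow> complex) list) \<Rightarrow> bool" where
  "respects_ports D G p s \<longleftrightarrow>
     (\<forall>v\<in>verts G. (\<forall>e\<in>edges G. v \<in> e \<longrightarrow> port (s e) (p v) \<in> D) \<and>
                  inj_on (\<lambda>e. port (s e) (p v)) {e \<in> edges G. v \<in> e})"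

definition orthogonal_ports :: "complex set" where
  "orthogonal_ports = {cis (real k * pi / 2) | k. k < 4}"

definition octilinear_ports :: "complex set" where
  "octilinear_ports = {cis (real k * pi / 4) | k. k < 8}"

definition smooth_orthogonal_drawing ::
    "'a graph \<Rightarrow> ('a \<Rightarrow> complex) \<Rightarrow> ('a set \<Rightarrow> (real \<Rightarrow> complex) list) \<Rightarrow> bool" where
  "smooth_orthogonal_drawing G p s \<longleftrightarrow>
     planar_drawing G p (\<lambda>e. join_segments (s e)) \<and>
     (\<forall>e\<in>edges G. smooth_orthogonal_edge (s e)) \<and>
     respects_ports orthogonal_ports G p s"

definition octilinear_drawing ::
    "'a graph \<Rightarrow> ('a \<Rightarrow> complex) \<Rightarrow> ('a set \<Rightarrow> (real \<Rightarrow> complex) list) \<Rightarrow> bool" where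
  "octilinear_drawing G p s \<longleftrightarrow>
     planar_drawing G p (\<lambda>e. join_segments (s e)) \<and>
     (\<forall>e\<in>edges G. octilinear_edge (s e)) \<and>
     respects_ports octilinear_ports G p s"

definition bendless :: "'a graph \<Rightarrow> ('a set \<Rightarrow> (real \<Rightarrow> complex) list) \<Rightarrow> bool" where
  "bendless G s \<longleftrightarrow> (\<forall>e\<in>edges G. length (s e) = 1)"

end

theory Submission
  imports Defs
begin

text \<open>
  The octagonal antiprism has a bendless drawing of either kind on the integer grid: an octilinear one
  on a convex octagon around a square, and a smooth orthogonal one made of unit segments, unit
  quarter arcs and two three-quarter arcs of radius 2. In both drawings the relative interiors of
  the edges run through pairwise distinct cells (vertices, open sides and open faces) of the unit grid,
  none of which is the position of a vertex, so planarity is a finite check on integers. Placing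
  \<open>m\<close> translated copies side by side gives a 4-regular graph on \<open>16 m\<close> vertices for every \<open>m\<close>.
\<close>

section \<open>Disjoint copies of a drawing\<close>

text \<open>In a 4-regular orthogonal drawing every vertex uses all four ports, so neighbouring
  edges at a vertex leave a quarter turn apart. At each vertex of the outer octagon the other two
  edges point inwards, so a counterclockwise walk turns right 8 times. To close up with one full
  left turn, its edges must supply 12 quarter turns to the left: six quarter arcs and two
  three-quarter arcs do this. On the inner octagon the walk turns left 8 times, so its edges must
  give back 4 quarter turns: four quarter arcs, the other four edges straight. Sharing no cell is
  sufficient for two edges to be disjoint, but not necessary. The drawings are arranged so that
  every cell is entered by at most one edge; no intersection of circles is ever computed. Endpoints
  stay out of an edge's cells, since adjacent edges do meet there. The type of edge is a parameter
  \<open>Q\<close> and the port set a parameter \<open>D\<close>, so that copying and tabulating are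
  proved once for both styles.\<close>

definition bendless_drawing ::
    "((real \<Rightarrow> complex) list \<Rightarrow> bool) \<Rightarrow> complex set \<Rightarrow> 'a graph \<Rightarrow> ('a \<Rightarrow> complex) \<Rightarrow>
     ('a set \<Rightarrow> real \<Rightarrow> complex) \<Rightarrow> bool" where
  "bendless_drawing Q D G p c \<longleftrightarrow>
     planar_drawing G p c \<and> (\<forall>e\<in>edges G. Q [c e]) \<and> respects_ports D G p (\<lambda>e. [c e])"

text \<open>Copy \<open>j\<close> occupies the block of numbers from \<open>N * j\<close> on, so
  \<open>div N\<close> recovers the copy and \<open>mod N\<close> the original vertex, and the
  vertex type remains \<open>nat\<close>.\<close>

definition copies :: "nat \<Rightarrow> nat \<Rightarrow> nat graph \<Rightarrow> nat graph" where
  "copies N m G = ({..<N * m}, {(+) (N * j) ` e | j e. j < m \<and> e \<in> edges G})"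

text \<open>Both functions have the same set of derivatives, so the choice operator behind
  \<open>vector_derivative\<close> picks the same value, even where it is not unique or does not
  exist.\<close>

lemma vector_derivative_translation:
  "vector_derivative ((+) w \<circ> g) F = vector_derivative g F"
proof -
  have "((+) w \<circ> g has_vector_derivative d) F \<longleftrightarrow> (g has_vector_derivative d) F" for d
    using has_vector_derivative_add[OF has_vector_derivative_const[of w F]]
      \<comment> \<open>Adding the constant \<open>-w\<close> undoes the translation and gives the
        converse implication.\<close>
      has_vector_derivative_add[OF has_vector_derivative_const[of "-w" F], of "(+) w \<circ> g" d]
    by (fastforce simp: o_def)
  then show ?thesis
    by (simp add: vector_derivative_def)
qed

lemma start_dir_translation [simp]: "start_dir ((+) w \<circ> g) = start_dir g"
  by (simp add: start_dir_def vector_derivative_translation)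

lemma end_dir_translation [simp]: "end_dir ((+) w \<circ> g) = end_dir g"
  by (simp add: end_dir_def vector_derivative_translation)

lemma port_translation: "port [(+) w \<circ> g] (w + x) = port [g] x"
  by (simp add: port_def pathstart_translation)

lemma linepath_translation: "(+) w \<circ> linepath a b = linepath (w + a) (w + b)"
  by (auto simp: linepath_def algebra_simps)

lemma part_circlepath_translation:
  "(+) w \<circ> part_circlepath z r s t = part_circlepath (w + z) r s t"
  by (auto simp: part_circlepath_def algebra_simps)

lemma axis_aligned_segment_translation:
  "axis_aligned_segment g \<Longrightarrow> axis_aligned_segment ((+) w \<circ> g)"
  unfolding axis_aligned_segment_def
  by (metis add_diff_cancel_left add_left_cancel linepath_translation)

lemma diagonal_segment_translation:
  "diagonal_segment g \<Longrightarrow> diagonal_segment ((+) w \<circ> g)"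
  unfolding diagonal_segment_def
  by (metis add_diff_cancel_left add_left_cancel linepath_translation)

lemma axis_aligned_arc_translation:
  "axis_aligned_arc g \<Longrightarrow> axis_aligned_arc ((+) w \<circ> g)"
  unfolding axis_aligned_arc_def start_dir_translation end_dir_translation
  by (metis part_circlepath_translation)

lemma smooth_orthogonal_edge_translation:
  "smooth_orthogonal_edge [g] \<Longrightarrow> smooth_orthogonal_edge [(+) w \<circ> g]"
  by (auto simp: smooth_orthogonal_edge_def axis_aligned_segment_translation
      axis_aligned_arc_translation)

lemma octilinear_edge_translation:
  "octilinear_edge [g] \<Longrightarrow> octilinear_edge [(+) w \<circ> g]"
  by (auto simp: octilinear_edge_def axis_aligned_segment_translation
      diagonal_segment_translation)

lemma copies_edgeE:
  assumes "e \<in> edges (copies N m G)"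
  obtains j e0 where "j < m" "e0 \<in> edges G" "e = (+) (N * j) ` e0"
  using assms by (auto simp: copies_def)

lemma verts_copies:
  assumes "verts G = {..<N}"
  shows "verts (copies N m G) = (\<Union>j<m. (+) (N * j) ` verts G)"
proof (intro equalityI subsetI)
  fix v assume "v \<in> verts (copies N m G)"
  then have v: "v < N * m"
    by (simp add: copies_def)
  then have "v div N < m" "v mod N < N"
    by (simp_all add: less_mult_imp_div_less mult.commute) (metis mod_less_divisor mult_is_0 gr0I less_nat_zero_code)
  moreover have "v = N * (v div N) + v mod N"
    by simp
  ultimately show "v \<in> (\<Union>j<m. (+) (N * j) ` verts G)"
    using assms by blast
next
  fix v assume "v \<in> (\<Union>j<m. (+) (N * j) ` verts G)"
  then obtain j u where "j < m" "u < N" "v = N * j + u"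
    using assms by auto
  moreover from \<open>j < m\<close> have "N * Suc j \<le> N * m"
    by (intro mult_le_mono2) simp
  ultimately show "v \<in> verts (copies N m G)"
    by (simp add: copies_def)
qed

context
  fixes G :: "nat graph" and N :: nat
  assumes simple: "simple_graph G" and verts: "verts G = {..<N}"
begin

lemma edge_less: "e \<in> edges G \<Longrightarrow> u \<in> e \<Longrightarrow> u < N"
  using simple verts by (auto simp: simple_graph_def)

lemma edge_nonempty: "e \<in> edges G \<Longrightarrow> e \<noteq> {}"
  using simple by (auto simp: simple_graph_def)

lemma shifted_index [simp]:
  assumes "u < N"
  shows "(N * j + u) div N = j" "(N * j + u) mod N = u"
  using assms by auto

lemma shifted_edge_mod: "e \<in> edges G \<Longrightarrow> (\<lambda>v. v mod N) ` (+) (N * j) ` e = e"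
  by (force simp: image_image dest: edge_less)

lemma shifted_edge_div: "e \<in> edges G \<Longrightarrow> (\<lambda>v. v div N) ` (+) (N * j) ` e = {j}"
  using edge_nonempty by (force simp: image_image dest: edge_less)

lemma shifted_mem_edge:
  assumes "e \<in> edges G" "u < N"
  shows "N * i + u \<in> (+) (N * j) ` e \<longleftrightarrow> i = j \<and> u \<in> e"
proof
  assume "N * i + u \<in> (+) (N * j) ` e"
  then obtain u' where u': "u' \<in> e" "N * i + u = N * j + u'"
    by auto
  then have "u' < N"
    using assms(1) edge_less by blast
  then show "i = j \<and> u \<in> e"
    using u' shifted_index[of u i] shifted_index[of u' j] assms(2) by metis
qed auto

text \<open>Incidence never leaves a block, so degrees and port conditions in the copies reduce to
  those of \<open>G\<close>.\<close>

lemma copies_incident: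
  assumes "j < m" "u < N"
  shows "{e \<in> edges (copies N m G). N * j + u \<in> e} = (`) ((+) (N * j)) ` {e \<in> edges G. u \<in> e}"
proof (intro equalityI subsetI)
  fix e assume "e \<in> {e \<in> edges (copies N m G). N * j + u \<in> e}"
  then obtain i e0 where "e0 \<in> edges G" "e = (+) (N * i) ` e0" "N * j + u \<in> e"
    by (auto elim: copies_edgeE)
  then show "e \<in> (`) ((+) (N * j)) ` {e \<in> edges G. u \<in> e}"
    using assms(2) by (simp add: shifted_mem_edge)
next
  fix e assume "e \<in> (`) ((+) (N * j)) ` {e \<in> edges G. u \<in> e}"
  then show "e \<in> {e \<in> edges (copies N m G). N * j + u \<in> e}"
    using assms by (auto simp: copies_def)
qed

lemma simple_graph_copies: "simple_graph (copies N m G)"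
proof -
  have "(+) (N * j) ` e \<subseteq> verts (copies N m G) \<and> card ((+) (N * j) ` e) = 2"
    if "j < m" "e \<in> edges G" for j e
  proof
    have "e \<subseteq> verts G"
      using that simple by (auto simp: simple_graph_def)
    then show "(+) (N * j) ` e \<subseteq> verts (copies N m G)"
      using that verts_copies[OF verts, of m] by auto
    show "card ((+) (N * j) ` e) = 2"
      using that simple by (simp add: simple_graph_def card_image)
  qed
  then show ?thesis
    unfolding simple_graph_def by (auto elim!: copies_edgeE) (simp add: copies_def)
qed

lemma regular_graph_copies:
  assumes "regular_graph k G"
  shows "regular_graph k (copies N m G)"
  unfolding regular_graph_def verts_copies[OF verts]
proof (intro ballI, elim UN_E imageE)
  fix v j u assume "j \<in> {..<m}" "v = N * j + u" "u \<in> verts G"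
  moreover have "inj_on ((`) ((+) (N * j))) X" for X
    by (rule inj_onI) (simp add: inj_image_eq_iff)
  ultimately show "degree_of (copies N m G) v = k"
    using assms by (simp add: degree_of_def regular_graph_def copies_incident verts card_image)
qed

text \<open>The copies are placed side by side, each in a vertical strip of its own.\<close>

lemma bendless_drawing_copies:
  assumes drawing: "bendless_drawing Q D G p c"
    and Q: "\<And>w g. Q [g] \<Longrightarrow> Q [(+) w \<circ> g]"
  shows "\<exists>p c. bendless_drawing Q D (copies N m G) p c"
proof -
  \<comment> \<open>The whole drawing as a point set: a finite union of compact curves and finitely
    many points, hence bounded.\<close>
  define R where "R = (\<Union>e\<in>edges G. path_image (c e)) \<union> p ` verts G"
  have planar: "planar_drawing G p c"
    and ports: "respects_ports D G p (\<lambda>e. [c e])"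
    using drawing by (auto simp: bendless_drawing_def)
  have "edges G \<subseteq> Pow (verts G)"
    using simple by (auto simp: simple_graph_def)
  then have "finite (edges G)"
    using simple by (auto simp: simple_graph_def intro: finite_subset)
  moreover have "bounded (path_image (c e))" if "e \<in> edges G" for e
    using planar that bounded_path_image arc_imp_path by (auto simp: planar_drawing_def)
  ultimately have "bounded R"
    by (auto simp: R_def verts finite_imp_bounded)
  then obtain B where B: "\<And>z. z \<in> R \<Longrightarrow> norm z \<le> B" "B > 0"
    by (meson bounded_pos)
  \<comment> \<open>Each copy has horizontal extent at most \<open>2 * B\<close>, so a shift by
    \<open>3 * B\<close> separates neighbouring copies.\<close>
  define sh :: "nat \<Rightarrow> complex" where "sh j = of_real (3 * B * real j)" for j
  have sep: "i = j" if "x \<in> R" "y \<in> R" "sh i + x = sh j + y" for i j x y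
  proof (rule ccontr)
    assume "i \<noteq> j"
    then have "1 \<le> \<bar>real i - real j\<bar>"
      by linarith
    then have "3 * B * 1 \<le> 3 * B * \<bar>real i - real j\<bar>"
      using B(2) by (intro mult_left_mono) auto
    also have "\<dots> = \<bar>Re (sh i) - Re (sh j)\<bar>"
      using B(2) by (simp add: sh_def abs_mult flip: right_diff_distrib)
    also have "Re (sh i) - Re (sh j) = Re y - Re x"
      using arg_cong[OF that(3), of Re] by simp
    also have "\<bar>Re y - Re x\<bar> \<le> norm y + norm x"
      using abs_Re_le_cmod[of x] abs_Re_le_cmod[of y] by linarith
    also have "\<dots> \<le> 2 * B"
      using B(1)[OF that(1)] B(1)[OF that(2)] by simp
    finally show False
      using B(2) by simp
  qed
  define p' where "p' v = sh (v div N) + p (v mod N)" for v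
  \<comment> \<open>All vertices of an edge lie in one block, so the image under
    \<open>div N\<close> is a singleton whose element names the copy.\<close>
  define c' where
    "c' e = (+) (sh (the_elem ((\<lambda>v. v div N) ` e))) \<circ> c ((\<lambda>v. v mod N) ` e)" for e
  have p': "p' (N * j + u) = sh j + p u" if "u < N" for j u
    using that by (simp add: p'_def)
  have c': "c' ((+) (N * j) ` e) = (+) (sh j) \<circ> c e" if "e \<in> edges G" for j e
    by (simp only: c'_def shifted_edge_mod[OF that] shifted_edge_div[OF that] the_elem_eq)
  have p'_edge: "p' ` (+) (N * j) ` e = (+) (sh j) ` p ` e" if "e \<in> edges G" for j e
    using edge_less[OF that] by (force simp: image_image p')
  have p'_verts: "p' ` verts (copies N m G) = (\<Union>j<m. (+) (sh j) ` p ` verts G)"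
    unfolding verts_copies[OF verts] by (force simp: verts image_image p')
  have edge_R: "path_image (c e) \<subseteq> R" if "e \<in> edges G" for e
    using that by (auto simp: R_def)
  have verts_R: "p u \<in> R" if "u < N" for u
    using that by (auto simp: R_def verts)
  have "inj_on p' (verts (copies N m G))"
  proof (rule inj_onI)
    fix v w assume vw: "v \<in> verts (copies N m G)" "w \<in> verts (copies N m G)" "p' v = p' w"
    obtain i u where u: "u < N" "v = N * i + u"
      using vw(1) unfolding verts_copies[OF verts] by (auto simp: verts)
    obtain j u' where u': "u' < N" "w = N * j + u'"
      using vw(2) unfolding verts_copies[OF verts] by (auto simp: verts)
    have eq: "sh i + p u = sh j + p u'"
      using vw(3) u u' by (simp add: p')
    then have "i = j"
      using sep verts_R u u' by blast
    moreover have "u = u'"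
      using eq \<open>i = j\<close> planar u u' by (auto simp: planar_drawing_def verts inj_on_def)
    ultimately show "v = w"
      using u u' by simp
  qed
  moreover have "arc (c' e) \<and> {pathstart (c' e), pathfinish (c' e)} = p' ` e \<and>
      path_image (c' e) \<inter> p' ` verts (copies N m G) = p' ` e"
    if "e \<in> edges (copies N m G)" for e
    using that
  proof (rule copies_edgeE)
    fix j e0 assume j: "j < m" "e0 \<in> edges G" "e = (+) (N * j) ` e0"
    have e0: "arc (c e0)" "{pathstart (c e0), pathfinish (c e0)} = p ` e0"
      "path_image (c e0) \<inter> p ` verts G = p ` e0"
      using planar j(2) by (auto simp: planar_drawing_def)
    have "path_image (c' e) \<inter> p' ` verts (copies N m G) = (+) (sh j) ` (path_image (c e0) \<inter> p ` verts G)"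
    proof (intro equalityI subsetI)
      fix z assume "z \<in> path_image (c' e) \<inter> p' ` verts (copies N m G)"
      then obtain x i u where z: "x \<in> path_image (c e0)" "z = sh j + x" "u < N" "z = sh i + p u"
        unfolding p'_verts j(3) c'[OF j(2)] path_image_translation by (auto simp: verts)
      then have "i = j"
        using sep edge_R[OF j(2)] verts_R by (metis subsetD)
      then show "z \<in> (+) (sh j) ` (path_image (c e0) \<inter> p ` verts G)"
        using z by (auto simp: verts)
    next
      fix z assume "z \<in> (+) (sh j) ` (path_image (c e0) \<inter> p ` verts G)"
      then show "z \<in> path_image (c' e) \<inter> p' ` verts (copies N m G)"
        unfolding p'_verts j(3) c'[OF j(2)] path_image_translation using j(1) by blast
    qed
    moreover have "{pathstart (c' e), pathfinish (c' e)} = (+) (sh j) ` {pathstart (c e0), pathfinish (c e0)}"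
      by (simp add: j(3) c'[OF j(2)] pathstart_translation pathfinish_translation)
    ultimately show ?thesis
      using e0 by (simp add: p'_edge[OF j(2)] j(3) c'[OF j(2)] arc_translation_eq)
  qed
  moreover have "path_image (c' e) \<inter> path_image (c' f) \<subseteq> p' ` (e \<inter> f)"
    if ef: "e \<in> edges (copies N m G)" "f \<in> edges (copies N m G)" "e \<noteq> f" for e f
  proof -
    obtain i e0 where e: "e0 \<in> edges G" "e = (+) (N * i) ` e0"
      using ef(1) by (blast elim: copies_edgeE)
    obtain j f0 where f: "f0 \<in> edges G" "f = (+) (N * j) ` f0"
      using ef(2) by (blast elim: copies_edgeE)
    show ?thesis
    proof (cases "i = j")
      case True
      then have "e0 \<noteq> f0"
        using ef(3) e f by auto
      then have "path_image (c e0) \<inter> path_image (c f0) \<subseteq> p ` (e0 \<inter> f0)"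
        using planar e f by (simp add: planar_drawing_def)
      then have "path_image (c' e) \<inter> path_image (c' f) \<subseteq> (+) (sh i) ` p ` (e0 \<inter> f0)"
        unfolding e f True c'[OF e(1)] c'[OF f(1)] path_image_translation by auto
      also have "\<dots> = p' ` (+) (N * i) ` (e0 \<inter> f0)"
        using edge_less[OF e(1)] by (force simp: image_image p')
      finally show ?thesis
        using e f True by (auto simp: image_image)
    next
      case False
      then have "path_image (c' e) \<inter> path_image (c' f) = {}"
        unfolding e f c'[OF e(1)] c'[OF f(1)] path_image_translation
        using sep edge_R[OF e(1)] edge_R[OF f(1)] by blast
      then show ?thesis
        by simp
    qed
  qed
  ultimately have "planar_drawing (copies N m G) p' c'"
    by (simp add: planar_drawing_def)
  moreover have "Q [c' e]" if "e \<in> edges (copies N m G)" for e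
    using that drawing by (auto elim!: copies_edgeE simp: c' Q bendless_drawing_def)
  moreover have "respects_ports D (copies N m G) p' (\<lambda>e. [c' e])"
    unfolding respects_ports_def verts_copies[OF verts]
  proof (intro ballI, elim UN_E imageE)
    fix v j u assume v: "j \<in> {..<m}" "v = N * j + u" "u \<in> verts G"
    then have ju: "j < m" "u < N"
      by (auto simp: verts)
    have shifted: "port [c' ((+) (N * j) ` e)] (p' v) = port [c e] (p u)" if "e \<in> edges G" for e
      using that ju v by (simp add: p' c' port_translation)
    have inc: "{e \<in> edges (copies N m G). v \<in> e} = (`) ((+) (N * j)) ` {e \<in> edges G. u \<in> e}"
      using copies_incident[OF ju] v by simp
    have D: "\<forall>e\<in>edges G. u \<in> e \<longrightarrow> port [c e] (p u) \<in> D"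
      and inj: "inj_on (\<lambda>e. port [c e] (p u)) {e \<in> edges G. u \<in> e}"
      using ports v(3) by (auto simp: respects_ports_def)
    have "\<forall>e\<in>{e \<in> edges (copies N m G). v \<in> e}. port [c' e] (p' v) \<in> D"
      unfolding inc using D shifted by auto
    moreover have "inj_on (\<lambda>e. port [c' e] (p' v)) {e \<in> edges (copies N m G). v \<in> e}"
      unfolding inc using inj shifted by (fastforce simp: inj_on_def)
    ultimately show "(\<forall>e\<in>edges (copies N m G). v \<in> e \<longrightarrow> port [c' e] (p' v) \<in> D) \<and>
        inj_on (\<lambda>e. port [c' e] (p' v)) {e \<in> edges (copies N m G). v \<in> e}"
      by blast
  qed
  ultimately show ?thesis
    by (auto simp: bendless_drawing_def)
qed

end

section \<open>Segments on the integer grid\<close>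

definition pt :: "int \<times> int \<Rightarrow> complex" where
  "pt v = Complex (of_int (fst v)) (of_int (snd v))"

text \<open>Diagonal directions have length \<open>sqrt 2\<close>, not 1: this keeps all endpoints
  integral. \<open>sgn\<close> restores the unit port vector where it is needed.\<close>

definition oct_dir :: "nat \<Rightarrow> int \<times> int" where
  "oct_dir k = [(1, 0), (1, 1), (0, 1), (-1, 1), (-1, 0), (-1, -1), (0, -1), (1, -1)] ! (k mod 8)"

text \<open>
  \<open>Line x y k n\<close> runs from \<open>(x, y)\<close> to \<open>(x, y) + n oct_dir k\<close>. The arcs have centre \<open>(x, y)\<close> and
  are traversed counterclockwise from the angle \<open>a \<pi> / 2\<close>; quarter arcs have radius 1 and
  three-quarter arcs have radius 2.
\<close>

datatype seg = Line int int nat nat | Quarter int int nat | ThreeQuarters int int nat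

fun seg_path :: "seg \<Rightarrow> real \<Rightarrow> complex" where
  "seg_path (Line x y k n) = linepath (pt (x, y)) (pt (x, y) + of_nat n * pt (oct_dir k))"
| "seg_path (Quarter x y a) = part_circlepath (pt (x, y)) 1 (real a * pi / 2) (real (a + 1) * pi / 2)"
| "seg_path (ThreeQuarters x y a) =
     part_circlepath (pt (x, y)) 2 (real a * pi / 2) (real (a + 3) * pi / 2)"

definition move :: "int \<times> int \<Rightarrow> int \<Rightarrow> nat \<Rightarrow> int \<times> int" where
  "move v n k = (fst v + n * fst (oct_dir k), snd v + n * snd (oct_dir k))"

fun seg_start :: "seg \<Rightarrow> int \<times> int" where
  "seg_start (Line x y k n) = (x, y)"
| "seg_start (Quarter x y a) = move (x, y) 1 (2 * a)"
| "seg_start (ThreeQuarters x y a) = move (x, y) 2 (2 * a)"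

fun seg_finish :: "seg \<Rightarrow> int \<times> int" where
  "seg_finish (Line x y k n) = move (x, y) (int n) k"
| "seg_finish (Quarter x y a) = move (x, y) 1 (2 * a + 2)"
| "seg_finish (ThreeQuarters x y a) = move (x, y) 2 (2 * a + 6)"

text \<open>Ports are numbered by multiples of the angle \<open>\<pi> / 4\<close>.\<close>

fun seg_ports :: "seg \<Rightarrow> nat \<times> nat" where
  "seg_ports (Line x y k n) = (k mod 8, (k + 4) mod 8)"
| "seg_ports (Quarter x y a) = ((2 * a + 2) mod 8, (2 * a) mod 8)"
| "seg_ports (ThreeQuarters x y a) = ((2 * a + 2) mod 8, (2 * a + 4) mod 8)"

text \<open>
  The vertices, open sides and open faces of the unit grid partition the plane; each of these cells
  is identified by the rounded coordinates of its points.
\<close>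

type_synonym cell = "int \<times> int \<times> int \<times> int"

definition cell_of :: "complex \<Rightarrow> cell" where
  "cell_of z = (\<lfloor>Re z\<rfloor>, \<lceil>Re z\<rceil>, \<lfloor>Im z\<rfloor>, \<lceil>Im z\<rceil>)"

text \<open>The cell next to the grid point \<open>v\<close> on the side of \<open>d\<close>: the
  vertex itself if \<open>d\<close> is zero, an open side if one coordinate of \<open>d\<close>
  vanishes, an open face if none does.\<close>

definition cell_at :: "int \<times> int \<Rightarrow> int \<times> int \<Rightarrow> cell" where
  "cell_at v d = (fst v + min 0 (fst d), fst v + max 0 (fst d),
                  snd v + min 0 (snd d), snd v + max 0 (snd d))"

text \<open>The cells met by the circle of radius 2 about \<open>(x, y)\<close> in the open quadrant in direction \<open>(s, t)\<close>.\<close>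

definition wide_quarter_cells :: "int \<Rightarrow> int \<Rightarrow> int \<times> int \<Rightarrow> cell list" where
  "wide_quarter_cells x y d = (case d of (s, t) \<Rightarrow>
     [cell_at (x, y + t) (s, t), cell_at (x + s, y + t) (0, t), cell_at (x + s, y + t) (s, t),
      cell_at (x + s, y + t) (s, 0), cell_at (x + s, y) (s, t)])"

text \<open>Only the relative interior is covered: a line of length \<open>n\<close> has
  \<open>n\<close> unit pieces but \<open>n - 1\<close> inner grid points, and a three-quarter arc
  has three open quadrants but two inner quadrant boundaries. This is why the second ranges start at
  1.\<close>

fun seg_cells :: "seg \<Rightarrow> cell list" where
  "seg_cells (Line x y k n) =
     map (\<lambda>i. cell_at (move (x, y) (int i) k) (oct_dir k)) [0..<n] @
     map (\<lambda>i. cell_at (move (x, y) (int i) k) (0, 0)) [1..<n]"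
| "seg_cells (Quarter x y a) = [cell_at (x, y) (oct_dir (2 * a + 1))]"
| "seg_cells (ThreeQuarters x y a) =
     concat (map (\<lambda>j. wide_quarter_cells x y (oct_dir (2 * (a + j) + 1))) [0..<3]) @
     map (\<lambda>j. cell_at (move (x, y) 2 (2 * (a + j))) (0, 0)) [1..<3]"

fun proper_seg :: "seg \<Rightarrow> bool" where
  "proper_seg (Line x y k n) \<longleftrightarrow> n > 0"
| "proper_seg s \<longleftrightarrow> True"

section \<open>Integer directions and eighth roots of unity\<close>

lemma pt_inj [simp]: "pt u = pt v \<longleftrightarrow> u = v"
  by (auto simp: pt_def prod_eq_iff)

lemma pt_move: "pt (move v n k) = pt v + of_int n * pt (oct_dir k)"
  by (simp add: pt_def move_def complex_eq_iff)

lemma mod_8_cases: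
  obtains "k mod 8 = (0 :: nat)" | "k mod 8 = 1" | "k mod 8 = 2" | "k mod 8 = 3"
    | "k mod 8 = 4" | "k mod 8 = 5" | "k mod 8 = 6" | "k mod 8 = 7"
proof -
  have "k mod 8 < 8"
    by simp
  then have "k mod 8 = 0 \<or> k mod 8 = 1 \<or> k mod 8 = 2 \<or> k mod 8 = 3 \<or>
      k mod 8 = 4 \<or> k mod 8 = 5 \<or> k mod 8 = 6 \<or> k mod 8 = 7"
    by presburger
  then show ?thesis
    by (elim disjE) (fact that)+
qed

definition oct_cis :: "nat \<Rightarrow> complex" where
  "oct_cis k = cis (real k * pi / 4)"

lemma oct_cis_mod: "oct_cis (k mod 8) = oct_cis k"
proof -
  have "oct_cis (8 * q + r) = oct_cis r" for q r
  proof -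
    have "oct_cis (8 * q + r) = cis (2 * pi * real q) * oct_cis r"
      unfolding oct_cis_def cis_mult by (simp add: field_simps)
    then show ?thesis
      by (simp add: cis_multiple_2pi)
  qed
  then show ?thesis
    by (metis mult_div_mod_eq)
qed

lemma oct_cis_add: "oct_cis (j + k) = oct_cis j * oct_cis k"
  by (simp add: oct_cis_def cis_mult field_simps)

lemma oct_cis_2 [simp]: "oct_cis 2 = \<i>"
  by (simp add: oct_cis_def)

lemma oct_cis_4 [simp]: "oct_cis 4 = -1"
  by (simp add: oct_cis_def)

text \<open>Links the integer direction table to the port vectors. The values at 0, 1, 2 and 4 are
  known and the others are products of these.\<close>

lemma sgn_pt_oct_dir: "sgn (pt (oct_dir k)) = oct_cis k"
proof -
  have 1: "oct_cis 1 = Complex (1 / sqrt 2) (1 / sqrt 2)"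
    by (simp add: oct_cis_def complex_eq_iff cos_45 sin_45 real_div_sqrt field_simps)
  have 0: "oct_cis 0 = 1"
    by (simp add: oct_cis_def)
  have eqs: "oct_cis 3 = oct_cis 2 * oct_cis 1" "oct_cis 5 = oct_cis 4 * oct_cis 1"
    "oct_cis 6 = oct_cis 4 * oct_cis 2" "oct_cis 7 = oct_cis 6 * oct_cis 1"
    by (simp_all del: oct_cis_2 oct_cis_4 One_nat_def flip: oct_cis_add)
  have "sgn (pt (oct_dir k)) = oct_cis (k mod 8)"
    by (rule mod_8_cases[of k];
        simp add: oct_dir_def pt_def 0 1 eqs complex_eq_iff complex_sgn_def cmod_def divide_inverse
          del: One_nat_def)
  then show ?thesis
    by (simp add: oct_cis_mod)
qed

lemma oct_dir_even: "pt (oct_dir (2 * a)) = oct_cis (2 * a)"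
proof -
  have "even ((2 * a) mod 8)"
    by (simp add: dvd_mod)
  then have "norm (pt (oct_dir (2 * a))) = 1"
    by (cases rule: mod_8_cases[of "2 * a"]) (simp_all add: oct_dir_def pt_def cmod_def)
  then show ?thesis
    using sgn_pt_oct_dir[of "2 * a"] by (simp add: sgn_eq)
qed

lemma oct_dir_even_exp: "pt (oct_dir (2 * a)) = exp (\<i> * of_real (real a * pi / 2))"
  unfolding oct_dir_even oct_cis_def cis_conv_exp by (simp add: mult.commute)

lemma seg_pathstart: "pathstart (seg_path s) = pt (seg_start s)"
  by (cases s) (simp_all add: pt_move oct_dir_even_exp)

lemma seg_pathfinish: "pathfinish (seg_path s) = pt (seg_finish s)"
proof -
  \<comment> \<open>The endpoint index must have the visible form \<open>2 * _\<close> for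
    \<open>oct_dir_even_exp\<close> to apply.\<close>
  have "2 * a + 2 = 2 * (a + 1)" "2 * a + 6 = 2 * (a + 3)" for a :: nat
    by simp_all
  then show ?thesis
    by (cases s) (simp_all only: seg_path.simps seg_finish.simps pt_move oct_dir_even_exp
        pathfinish_part_circlepath pathfinish_linepath of_int_of_nat_eq of_int_numeral of_int_1 of_real_1 of_real_numeral)
qed

lemma arc_seg_path:
  assumes "proper_seg s"
  shows "arc (seg_path s)"
proof (cases s)
  case (Line x y k n)
  moreover have "pt (oct_dir k) \<noteq> 0"
    using sgn_pt_oct_dir[of k] by (auto simp: oct_cis_def)
  ultimately show ?thesis
    using assms by (simp add: arc_linepath)
qed (auto intro!: arc_part_circlepath simp: field_simps)

text \<open>The tangent of a counterclockwise arc at angle \<open>u\<close> is \<open>u\<close> plus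
  a quarter turn, that is 2 port steps. At the far end the port looks back along the edge, which
  adds half a turn: 6 steps in all.\<close>

lemma seg_dirs:
  assumes "proper_seg s"
  shows "start_dir (seg_path s) = oct_cis (fst (seg_ports s))"
    and "- end_dir (seg_path s) = oct_cis (snd (seg_ports s))"
proof -
  \<comment> \<open>The speed \<open>r * (t' - t)\<close> is a positive scalar and disappears under
    \<open>sgn\<close>.\<close>
  have arc: "sgn (\<i> * complex_of_real r * (of_real t' - of_real t) * exp (\<i> * of_real u)) = \<i> * exp (\<i> * of_real u)"
    if "r > 0" "t < t'" for r t t' u
  proof -
    have "\<i> * complex_of_real r * (of_real t' - of_real t) * exp (\<i> * of_real u) =
        (r * (t' - t)) *\<^sub>R (\<i> * exp (\<i> * of_real u))"
      by (simp add: scaleR_conv_of_real algebra_simps)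
    moreover have "norm (\<i> * exp (\<i> * of_real u)) = 1"
      by (simp add: norm_mult)
    ultimately show ?thesis
      using that by (simp only: sgn_scaleR) (simp add: sgn_eq)
  qed
  have line: "sgn (of_nat n * pt (oct_dir k)) = oct_cis k" if "n > 0" for n k
    using that by (simp add: sgn_mult sgn_pt_oct_dir sgn_eq[of "of_nat n"])
  have exp: "exp (\<i> * of_real (real a * pi / 2)) = oct_cis (2 * a)" for a
    by (metis oct_dir_even_exp oct_dir_even)
  have six: "oct_cis 6 = - \<i>"
    using oct_cis_add[of 4 2] by simp
  have circle: "start_dir (part_circlepath z r (real a * pi / 2) (real (a + m) * pi / 2)) = oct_cis (2 * a + 2)"
    "- end_dir (part_circlepath z r (real a * pi / 2) (real (a + m) * pi / 2)) = oct_cis (2 * (a + m) + 6)"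
    if "r > 0" "m > 0" for z r a m
  proof -
    have "real a * pi / 2 < real (a + m) * pi / 2"
      using that by simp
    then show "start_dir (part_circlepath z r (real a * pi / 2) (real (a + m) * pi / 2)) = oct_cis (2 * a + 2)"
      "- end_dir (part_circlepath z r (real a * pi / 2) (real (a + m) * pi / 2)) = oct_cis (2 * (a + m) + 6)"
      using that(1)
      unfolding start_dir_def end_dir_def
      by (simp_all only: vector_derivative_part_circlepath01 linepath_0' linepath_1' arc
          zero_le_one order_refl) (simp_all only: exp oct_cis_add, simp_all add: six)
  qed
  have "start_dir (seg_path s) = oct_cis (fst (seg_ports s)) \<and>
      - end_dir (seg_path s) = oct_cis (snd (seg_ports s))"
  proof (cases s)
    case (Line x y k n)
    then show ?thesis
      using assms
      by (simp add: start_dir_def end_dir_def vector_derivative_linepath_within line oct_cis_mod oct_cis_add)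
  next
    case (Quarter x y a)
    have "oct_cis (2 * (a + 1) + 6) = oct_cis (2 * a)"
      using oct_cis_mod[of "2 * (a + 1) + 6"] oct_cis_mod[of "2 * a"] by simp
    then show ?thesis
      using circle[of 1 1] by (simp only: Quarter seg_path.simps seg_ports.simps fst_conv snd_conv oct_cis_mod)
  next
    case (ThreeQuarters x y a)
    have "2 * (a + 3) + 6 = 2 * a + 4 + 8"
      by simp
    then have "oct_cis (2 * (a + 3) + 6) = oct_cis (2 * a + 4)"
      using oct_cis_mod[of "2 * (a + 3) + 6"] oct_cis_mod[of "2 * a + 4"] by (simp only: mod_add_self2)
    then show ?thesis
      using circle[of 2 3] by (simp only: ThreeQuarters seg_path.simps seg_ports.simps fst_conv snd_conv oct_cis_mod)
  qed
  then show "start_dir (seg_path s) = oct_cis (fst (seg_ports s))"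
    and "- end_dir (seg_path s) = oct_cis (snd (seg_ports s))"
    by simp_all
qed

section \<open>Cells met by the interior of a segment\<close>

lemma cell_of_offset:
  assumes "Re z = of_int (fst v) + f * of_int (fst d)" "Im z = of_int (snd v) + g * of_int (snd d)"
    and "0 < f" "f < 1" "0 < g" "g < 1"
    and "fst d \<in> {-1, 0, 1}" "snd d \<in> {-1, 0, 1}"
  shows "cell_of z = cell_at v d"
proof -
  have "\<lfloor>of_int X + h * of_int k\<rfloor> = X + min 0 k \<and> \<lceil>of_int X + h * of_int k\<rceil> = X + max 0 k"
    if "0 < h" "h < 1" "k \<in> {-1, 0, 1}" for h :: real and X k :: int
    using that by (auto simp: floor_eq_iff ceiling_eq_iff)
  then show ?thesis
    using assms by (simp add: cell_of_def cell_at_def)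
qed

lemma cell_of_pt: "cell_of (pt v) = cell_at v (0, 0)"
  by (simp add: cell_of_def cell_at_def pt_def)

lemma oct_dir_range: "fst (oct_dir k) \<in> {-1, 0, 1}" "snd (oct_dir k) \<in> {-1, 0, 1}"
  by (rule mod_8_cases[of k]; simp add: oct_dir_def)+

lemma oct_dir_odd_range: "fst (oct_dir (2 * a + 1)) \<in> {-1, 1}" "snd (oct_dir (2 * a + 1)) \<in> {-1, 1}"
proof -
  have "odd ((2 * a + 1) mod 8)"
    by (simp add: dvd_mod_iff)
  then show "fst (oct_dir (2 * a + 1)) \<in> {-1, 1}" "snd (oct_dir (2 * a + 1)) \<in> {-1, 1}"
    by (cases rule: mod_8_cases[of "2 * a + 1"]; simp add: oct_dir_def)+
qed

lemma line_cells:
  assumes "0 < t" "t < 1" "n > 0"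
  shows "cell_of (seg_path (Line x y k n) t) \<in> set (seg_cells (Line x y k n))"
proof -
  \<comment> \<open>\<open>i\<close> counts the completed unit steps and \<open>f\<close> is the
    remaining fraction; \<open>f = 0\<close> means an inner grid point, and then \<open>i\<close> is
    nonzero because \<open>t > 0\<close>.\<close>
  define i where "i = nat \<lfloor>t * real n\<rfloor>"
  define f where "f = t * real n - real i"
  have tn: "0 < t * real n" "t * real n < real n"
    using assms by auto
  have f: "0 \<le> f" "f < 1" "i < n"
    using tn unfolding f_def i_def by linarith+
  have path: "seg_path (Line x y k n) t = pt (move (x, y) (int i) k) + of_real f * pt (oct_dir k)"
    by (simp add: f_def pt_move linepath_def scaleR_conv_of_real algebra_simps)
  show ?thesis
  proof (cases "f = 0")
    case True
    then have "i \<noteq> 0"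
      using tn(1) by (auto simp: f_def)
    with True f(3) show ?thesis
      unfolding path by (auto simp: cell_of_pt)
  next
    case False
    have "cell_of (seg_path (Line x y k n) t) = cell_at (move (x, y) (int i) k) (oct_dir k)"
      unfolding path
      by (rule cell_of_offset[where f = f and g = f]) (use False f oct_dir_range in \<open>auto simp: pt_def\<close>)
    with f(3) show ?thesis
      by simp
  qed
qed

text \<open>Turning by \<open>a\<close> quarter turns permutes sine and cosine up to sign:
  \<open>f\<close> and \<open>g\<close> are \<open>cos u\<close> and \<open>sin u\<close> in one
  order or the other, and the odd direction \<open>2 * a + 1\<close> carries the signs of the
  quadrant.\<close>

lemma cis_quadrant:
  assumes "0 < u" "u < pi / 2"
  obtains f g where "cis (real a * pi / 2 + u) =
      Complex (f * of_int (fst (oct_dir (2 * a + 1)))) (g * of_int (snd (oct_dir (2 * a + 1))))"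
    "0 < f" "f < 1" "0 < g" "g < 1" "f\<^sup>2 + g\<^sup>2 = 1"
proof -
  have cs: "0 < cos u" "0 < sin u" "cos u < 1" "sin u < 1"
    using assms cos_gt_zero[of u] sin_gt_zero[of u] cos_monotone_0_pi[of 0 u] sin_monotone_2pi[of u "pi / 2"]
    by auto
  have 1: "cis (real a * pi / 2 + u) = pt (oct_dir (2 * a)) * cis u"
    unfolding oct_dir_even oct_cis_def cis_mult by (simp add: mult.commute)
  have even: "even ((2 * a) mod 8)"
    by (simp add: dvd_mod)
  \<comment> \<open>An even residue is never 7, so adding 1 does not wrap around.\<close>
  then have "Suc ((2 * a) mod 8) \<noteq> 8"
    by (metis even_Suc even_numeral)
  with even have "even ((2 * a) mod 8)" "(2 * a + 1) mod 8 = (2 * a) mod 8 + 1"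
    by (simp_all add: mod_Suc)
  then have "cis (real a * pi / 2 + u) = Complex (cos u * of_int (fst (oct_dir (2 * a + 1))))
        (sin u * of_int (snd (oct_dir (2 * a + 1)))) \<or>
      cis (real a * pi / 2 + u) = Complex (sin u * of_int (fst (oct_dir (2 * a + 1))))
        (cos u * of_int (snd (oct_dir (2 * a + 1))))"
    unfolding 1 oct_dir_def
    by (cases rule: mod_8_cases[of "2 * a"]) (simp_all only: pt_def, simp_all add: complex_eq_iff)
  then show ?thesis
    using that[OF _ cs(1,3,2,4)] that[OF _ cs(2,4,1,3)] by (elim disjE) simp_all
qed

lemma seg_path_arc:
  "seg_path (Quarter x y a) t = pt (x, y) + cis (real a * pi / 2 + t * (pi / 2))"
  "seg_path (ThreeQuarters x y a) t = pt (x, y) + 2 * cis (real a * pi / 2 + 3 * t * (pi / 2))"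
proof -
  have "linepath (real a * pi / 2) (real (a + m) * pi / 2) t = real a * pi / 2 + real m * t * (pi / 2)" for m
    by (simp add: linepath_def field_simps)
  from this[of 1] this[of 3] show
    "seg_path (Quarter x y a) t = pt (x, y) + cis (real a * pi / 2 + t * (pi / 2))"
    "seg_path (ThreeQuarters x y a) t = pt (x, y) + 2 * cis (real a * pi / 2 + 3 * t * (pi / 2))"
    by (simp_all only: seg_path.simps part_circlepath_def cis_conv_exp) simp_all
qed

lemma quarter_cells:
  assumes "0 < t" "t < 1"
  shows "cell_of (seg_path (Quarter x y a) t) \<in> set (seg_cells (Quarter x y a))"
proof -
  have "0 < t * (pi / 2)" "t * (pi / 2) < pi / 2"
    using assms by simp_all
  from cis_quadrant[OF this, of a] obtain f g where fg: "cis (real a * pi / 2 + t * (pi / 2)) =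
      Complex (f * of_int (fst (oct_dir (2 * a + 1)))) (g * of_int (snd (oct_dir (2 * a + 1))))"
    "0 < f" "f < 1" "0 < g" "g < 1"
    by blast
  have "cell_of (seg_path (Quarter x y a) t) = cell_at (x, y) (oct_dir (2 * a + 1))"
    unfolding seg_path_arc fg(1)
    by (intro cell_of_offset[where f = f and g = g] oct_dir_range fg) (simp_all add: pt_def)
  then show ?thesis
    by simp
qed

text \<open>If both \<open>F\<close> and \<open>G\<close> were at most 1, their squares could not
  sum to 4. So the face nearest the centre and its far corner are avoided, and the five cases
  remaining are the five listed cells.\<close>

lemma wide_quarter_cells:
  assumes "z = pt (x, y) + Complex (F * of_int s) (G * of_int t)" "s \<in> {-1, 1}" "t \<in> {-1, 1}"
    and "0 < F" "F < 2" "0 < G" "G < 2" "F\<^sup>2 + G\<^sup>2 = 4"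
  shows "cell_of z \<in> set (wide_quarter_cells x y (s, t))"
proof -
  have "1 < F \<or> 1 < G"
  proof (rule ccontr)
    assume "\<not> (1 < F \<or> 1 < G)"
    then have "F\<^sup>2 \<le> 1" "G\<^sup>2 \<le> 1"
      using assms by (auto simp: power_le_one)
    with assms(8) show False
      by linarith
  qed
  then consider "F < 1" "1 < G" | "F = 1" "1 < G" | "1 < F" "1 < G" | "1 < F" "G = 1" | "1 < F" "G < 1"
    by linarith
  then show ?thesis
  proof cases
    case 1
    have "cell_of z = cell_at (x, y + t) (s, t)"
      by (rule cell_of_offset[where f = F and g = "G - 1"])
        (use 1 assms in \<open>auto simp: pt_def algebra_simps\<close>)
    then show ?thesis by (simp add: wide_quarter_cells_def)
  next
    case 2
    have "cell_of z = cell_at (x + s, y + t) (0, t)"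
      \<comment> \<open>The direction has a zero first coordinate, so \<open>1 / 2\<close> is an
        arbitrary value between 0 and 1.\<close>
      by (rule cell_of_offset[where f = "1 / 2" and g = "G - 1"])
        (use 2 assms in \<open>auto simp: pt_def algebra_simps\<close>)
    then show ?thesis by (simp add: wide_quarter_cells_def)
  next
    case 3
    have "cell_of z = cell_at (x + s, y + t) (s, t)"
      by (rule cell_of_offset[where f = "F - 1" and g = "G - 1"])
        (use 3 assms in \<open>auto simp: pt_def algebra_simps\<close>)
    then show ?thesis by (simp add: wide_quarter_cells_def)
  next
    case 4
    have "cell_of z = cell_at (x + s, y + t) (s, 0)"
      by (rule cell_of_offset[where f = "F - 1" and g = "1 / 2"])
        (use 4 assms in \<open>auto simp: pt_def algebra_simps\<close>)
    then show ?thesis by (simp add: wide_quarter_cells_def)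
  next
    case 5
    have "cell_of z = cell_at (x + s, y) (s, t)"
      by (rule cell_of_offset[where f = "F - 1" and g = G])
        (use 5 assms in \<open>auto simp: pt_def algebra_simps\<close>)
    then show ?thesis by (simp add: wide_quarter_cells_def)
  qed
qed

lemma three_quarters_cells:
  assumes "0 < t" "t < 1"
  shows "cell_of (seg_path (ThreeQuarters x y a) t) \<in> set (seg_cells (ThreeQuarters x y a))"
proof -
  \<comment> \<open>\<open>j\<close> is the number of completed quadrants and \<open>u\<close> the
    fraction of the current one; \<open>u = 0\<close> marks a point on an axis through the
    centre.\<close>
  define j where "j = nat \<lfloor>3 * t\<rfloor>"
  define u where "u = 3 * t - real j"
  have u: "0 \<le> u" "u < 1" "j < 3"
    using assms unfolding u_def j_def by linarith+
  have path: "seg_path (ThreeQuarters x y a) t = pt (x, y) + 2 * cis (real (a + j) * pi / 2 + u * (pi / 2))"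
  proof -
    have "real a * pi / 2 + 3 * t * (pi / 2) = real (a + j) * pi / 2 + u * (pi / 2)"
      by (simp add: u_def field_simps)
    then show ?thesis
      by (simp only: seg_path_arc)
  qed
  show ?thesis
  proof (cases "u = 0")
    case True
    then have "j \<noteq> 0"
      using assms by (auto simp: u_def)
    moreover have "cis (real (a + j) * pi / 2) = pt (oct_dir (2 * (a + j)))"
    proof -
      have "real (a + j) * pi / 2 = real (2 * (a + j)) * pi / 4"
        by simp
      then show ?thesis
        by (simp only: oct_dir_even oct_cis_def)
    qed
    then have "seg_path (ThreeQuarters x y a) t = pt (move (x, y) 2 (2 * (a + j)))"
      unfolding path pt_move using True by simp
    ultimately show ?thesis
      using u(3) by (auto simp: cell_of_pt)
  next
    case False
    have "0 < u * (pi / 2)" "u * (pi / 2) < pi / 2"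
      using False u by simp_all
    from cis_quadrant[OF this, of "a + j"] obtain f g where fg: "cis (real (a + j) * pi / 2 + u * (pi / 2)) =
        Complex (f * of_int (fst (oct_dir (2 * (a + j) + 1)))) (g * of_int (snd (oct_dir (2 * (a + j) + 1))))"
      "0 < f" "f < 1" "0 < g" "g < 1" "f\<^sup>2 + g\<^sup>2 = 1"
      by blast
    have "cell_of (seg_path (ThreeQuarters x y a) t) \<in>
        set (wide_quarter_cells x y (fst (oct_dir (2 * (a + j) + 1)), snd (oct_dir (2 * (a + j) + 1))))"
      unfolding path fg(1) using fg(2-)
      by (intro wide_quarter_cells[where F = "2 * f" and G = "2 * g"] oct_dir_odd_range)
        (simp_all add: complex_eq_iff power_mult_distrib)
    then show ?thesis
      using u(3) by auto
  qed
qed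

lemma seg_cells:
  assumes "proper_seg s" "0 < t" "t < 1"
  shows "cell_of (seg_path s t) \<in> set (seg_cells s)"
  using assms line_cells quarter_cells three_quarters_cells by (cases s) (simp_all only: proper_seg.simps)

section \<open>Drawings given by tables\<close>

type_synonym table = "(nat \<times> nat \<times> seg) list"

text \<open>Rows list their ends in the direction of traversal, which for arcs is counterclockwise
  and may run from the larger index to the smaller; sorting makes the two tables comparable.\<close>

definition edge_ends :: "table \<Rightarrow> (nat \<times> nat) list" where
  "edge_ends T = map (\<lambda>(a, b, s). (min a b, max a b)) T"

definition seg_joins :: "(int \<times> int) list \<Rightarrow> nat \<times> nat \<times> seg \<Rightarrow> bool" where
  "seg_joins P = (\<lambda>(a, b, s). a < length P \<and> b < length P \<and> proper_seg s \<and>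
     seg_start s = P ! a \<and> seg_finish s = P ! b)"

definition half_edges :: "nat \<times> nat \<times> seg \<Rightarrow> (nat \<times> nat) list" where
  "half_edges = (\<lambda>(a, b, s). [(a, fst (seg_ports s)), (b, snd (seg_ports s))])"

text \<open>One \<open>distinct\<close> list of cells covers injectivity of the vertex placement,
  edges avoiding vertices, and edges avoiding each other. Distinct pairs of vertex and port number
  say that no port is used twice.\<close>

definition valid_table :: "(int \<times> int) list \<Rightarrow> table \<Rightarrow> bool" where
  "valid_table P T \<longleftrightarrow> list_all (seg_joins P) T \<and> distinct (edge_ends T) \<and>
     distinct (map (\<lambda>v. cell_at v (0, 0)) P @ concat (map (\<lambda>(a, b, s). seg_cells s) T)) \<and>
     distinct (concat (map half_edges T))"

definition graph_of :: "nat \<Rightarrow> (nat \<times> nat) list \<Rightarrow> nat graph" where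
  "graph_of n es = ({..<n}, (\<lambda>(a, b). {a, b}) ` set es)"

lemma distinct_concat_map_disjoint:
  assumes "distinct (concat (map f xs))" "x \<in> set xs" "y \<in> set xs" "x \<noteq> y"
  shows "set (f x) \<inter> set (f y) = {}"
  using assms by (induction xs) auto

lemma doubleton_min_max: "{min a b, max a b} = {a, b :: 'a :: linorder}"
  by (auto simp: min_def max_def)

lemma seg_path_image:
  assumes "proper_seg s" "z \<in> path_image (seg_path s)"
  shows "z \<in> {pt (seg_start s), pt (seg_finish s)} \<or> cell_of z \<in> set (seg_cells s)"
proof -
  obtain t where t: "0 \<le> t" "t \<le> 1" "z = seg_path s t"
    using assms(2) by (auto simp: path_image_def)
  then consider "t = 0" | "t = 1" | "0 < t" "t < 1"
    by linarith
  then show ?thesis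
    using t seg_cells[OF assms(1), of t] seg_pathstart[of s] seg_pathfinish[of s]
    by cases (auto simp: pathstart_def pathfinish_def)
qed

lemma oct_cis_inj: "inj_on oct_cis {..<8}"
proof -
  have "oct_cis = (\<lambda>k. cis (2 * pi * real k / real 8))"
    by (auto simp: oct_cis_def field_simps)
  moreover have "bij_betw (\<lambda>k. cis (2 * pi * real k / real 8)) {..<8} {z. z ^ 8 = 1}"
    by (rule Complex.bij_betw_roots_unity) simp
  ultimately show ?thesis
    by (metis bij_betw_imp_inj_on)
qed

lemma seg_ports_less: "fst (seg_ports s) < 8" "snd (seg_ports s) < 8"
  by (cases s; simp)+

text \<open>A point of an edge is an endpoint or lies in one of the edge's own cells. Those cells
  belong to no vertex and no other edge, so a common point of two edges is an endpoint of both, and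
  injectivity of \<open>p\<close> makes it a shared vertex.\<close>

lemma bendless_drawing_of_table:
  assumes valid: "valid_table P T"
    and Q: "\<And>a b s. (a, b, s) \<in> set T \<Longrightarrow> Q [seg_path s]"
    and D: "\<And>a b s. (a, b, s) \<in> set T \<Longrightarrow>
      oct_cis (fst (seg_ports s)) \<in> D \<and> oct_cis (snd (seg_ports s)) \<in> D"
  shows "\<exists>p c. bendless_drawing Q D (graph_of (length P) (edge_ends T)) p c"
proof -
  let ?G = "graph_of (length P) (edge_ends T)"
  let ?cells = "\<lambda>(a, b, s). seg_cells s"
  define p where "p v = pt (P ! v)" for v
  define tab where "tab = map (\<lambda>(a, b, s). ({a, b}, s)) T"
  define c where "c e = seg_path (the (map_of tab e))" for e
  have joins: "a < length P" "b < length P" "proper_seg s" "seg_start s = P ! a" "seg_finish s = P ! b"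
    if "(a, b, s) \<in> set T" for a b s
    using valid that by (auto simp: valid_table_def list_all_iff seg_joins_def)
  have edgesE: thesis if "e \<in> edges ?G" "\<And>a b s. (a, b, s) \<in> set T \<Longrightarrow> e = {a, b} \<Longrightarrow> thesis" for e thesis
  proof -
    have "edges ?G = (\<lambda>(a, b, s). {a, b}) ` set T"
      by (simp add: graph_of_def edge_ends_def image_image split_def doubleton_min_max)
    with that show ?thesis
      by auto
  qed
  have "map fst tab = map (\<lambda>(a, b). {a, b}) (edge_ends T)"
    by (auto simp: tab_def edge_ends_def doubleton_min_max)
  \<comment> \<open>A sorted pair is determined by its unordered edge, so distinct rows have
    distinct keys and \<open>map_of\<close> finds the right segment.\<close>
  moreover have "inj_on (\<lambda>(a, b). {a, b}) (set (edge_ends T))"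
    by (auto simp: inj_on_def edge_ends_def doubleton_eq_iff min_def max_def split: if_splits)
  ultimately have "distinct (map fst tab)"
    using valid by (simp add: distinct_map valid_table_def)
  then have c: "c {a, b} = seg_path s" if "(a, b, s) \<in> set T" for a b s
  proof -
    have "({a, b}, s) \<in> set tab"
      using that by (force simp: tab_def)
    with \<open>distinct (map fst tab)\<close> show ?thesis
      by (simp add: c_def)
  qed
  have arc: "arc (seg_path s)" "pathstart (seg_path s) = p a" "pathfinish (seg_path s) = p b"
    if "(a, b, s) \<in> set T" for a b s
    using joins[OF that] by (simp_all add: arc_seg_path seg_pathstart seg_pathfinish p_def)
  have neq: "p a \<noteq> p b" if "(a, b, s) \<in> set T" for a b s
    using arc[OF that] arc_distinct_ends by metis
  have distinct_cells: "distinct (map (\<lambda>v. cell_at v (0, 0)) P @ concat (map ?cells T))"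
    using valid by (simp add: valid_table_def)
  then have "distinct P"
    by (simp add: distinct_map)
  then have inj: "inj_on p {..<length P}"
    by (auto simp: inj_on_def p_def nth_eq_iff_index_eq)
  have image: "z = p a \<or> z = p b \<or> cell_of z \<in> set (seg_cells s)"
    if "(a, b, s) \<in> set T" "z \<in> path_image (seg_path s)" for a b s z
    using seg_path_image[OF joins(3)[OF that(1)] that(2)] joins[OF that(1)] by (auto simp: p_def)
  have vertex_cell: "cell_of (p v) \<notin> set (seg_cells s)" if "(a, b, s) \<in> set T" "v < length P" for a b s v
  proof -
    have "cell_of (p v) \<in> set (map (\<lambda>v. cell_at v (0, 0)) P)"
      using that(2) by (simp add: p_def cell_of_pt)
    moreover have "set (seg_cells s) \<subseteq> set (concat (map ?cells T))"
      using that(1) by force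
    ultimately show ?thesis
      using distinct_cells unfolding distinct_append by blast
  qed
  have "planar_drawing ?G p c"
    unfolding planar_drawing_def
  proof (intro conjI ballI impI)
    show "inj_on p (verts ?G)"
      using inj by (simp add: graph_of_def)
  next
    fix e assume "e \<in> edges ?G"
    then show "arc (c e)"
      by (rule edgesE) (simp add: c arc)
  next
    fix e assume "e \<in> edges ?G"
    then show "{pathstart (c e), pathfinish (c e)} = p ` e"
      by (rule edgesE) (simp add: c arc)
  next
    fix e assume "e \<in> edges ?G"
    then show "path_image (c e) \<inter> p ` verts ?G = p ` e"
    proof (rule edgesE)
      fix a b s assume T: "(a, b, s) \<in> set T" and e: "e = {a, b}"
      have "p ` e \<subseteq> path_image (c e)"
        using pathstart_in_path_image[of "seg_path s"] pathfinish_in_path_image[of "seg_path s"]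
        by (simp add: e c[OF T] arc[OF T])
      moreover have "p ` e \<subseteq> p ` verts ?G"
        using joins[OF T] by (auto simp: e graph_of_def)
      moreover have "path_image (c e) \<inter> p ` verts ?G \<subseteq> p ` e"
        using image[OF T] vertex_cell[OF T] by (auto simp: e c[OF T] graph_of_def)
      ultimately show ?thesis
        by blast
    qed
  next
    fix e f assume ef: "e \<in> edges ?G" "f \<in> edges ?G" "e \<noteq> f"
    obtain a b s where T: "(a, b, s) \<in> set T" and e: "e = {a, b}"
      using edgesE[OF ef(1)] by metis
    obtain a' b' s' where T': "(a', b', s') \<in> set T" and f: "f = {a', b'}"
      using edgesE[OF ef(2)] by metis
    have "set (seg_cells s) \<inter> set (seg_cells s') = {}"
      using distinct_concat_map_disjoint[of ?cells T "(a, b, s)" "(a', b', s')"] distinct_cells T T' ef(3) e f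
      by auto
    then have "z \<in> {p a, p b} \<inter> {p a', p b'}"
      if "z \<in> path_image (seg_path s)" "z \<in> path_image (seg_path s')" for z
      using image[OF T that(1)] image[OF T' that(2)] vertex_cell[OF T] vertex_cell[OF T']
        joins(1,2)[OF T] joins(1,2)[OF T'] by blast
    then have "path_image (c e) \<inter> path_image (c f) \<subseteq> p ` e \<inter> p ` f"
      by (auto simp: e f c[OF T] c[OF T'])
    also have "\<dots> = p ` (e \<inter> f)"
      using joins(1,2)[OF T] joins(1,2)[OF T'] by (intro inj_on_image_Int[OF inj, symmetric]) (auto simp: e f)
    finally show "path_image (c e) \<inter> path_image (c f) \<subseteq> p ` (e \<inter> f)" .
  qed
  moreover have "Q [c e]" if "e \<in> edges ?G" for e
    using that by (rule edgesE) (simp add: c Q)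
  moreover have "respects_ports D ?G p (\<lambda>e. [c e])"
    unfolding respects_ports_def
  proof (intro ballI)
    fix v assume v: "v \<in> verts ?G"
    have port: "\<exists>x\<in>set T. \<exists>k. e = {fst x, fst (snd x)} \<and> (v, k) \<in> set (half_edges x) \<and> k < 8 \<and>
        port [c e] (p v) = oct_cis k \<and> oct_cis k \<in> D" if "e \<in> edges ?G" "v \<in> e" for e
      using that(1)
    proof (rule edgesE)
      fix a b s assume T: "(a, b, s) \<in> set T" and e: "e = {a, b}"
      have "port [c e] (p a) = oct_cis (fst (seg_ports s))" "port [c e] (p b) = oct_cis (snd (seg_ports s))"
        using neq[OF T] seg_dirs[OF joins(3)[OF T]] by (simp_all add: port_def e c[OF T] arc[OF T])
      then show ?thesis
        using that(2) D[OF T] seg_ports_less[of s] by (intro bexI[OF _ T]) (auto simp: e half_edges_def)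
    qed
    have "inj_on (\<lambda>e. port [c e] (p v)) {e \<in> edges ?G. v \<in> e}"
    proof (rule inj_onI)
      fix e f assume e: "e \<in> {e \<in> edges ?G. v \<in> e}" and f: "f \<in> {e \<in> edges ?G. v \<in> e}"
        and eq: "port [c e] (p v) = port [c f] (p v)"
      obtain x k where x: "x \<in> set T" "e = {fst x, fst (snd x)}" "(v, k) \<in> set (half_edges x)" "k < 8"
        "port [c e] (p v) = oct_cis k"
        using port e by blast
      obtain y l where y: "y \<in> set T" "f = {fst y, fst (snd y)}" "(v, l) \<in> set (half_edges y)" "l < 8"
        "port [c f] (p v) = oct_cis l"
        using port f by blast
      have "k = l"
        using inj_onD[OF oct_cis_inj, of k l] eq x y by simp
      \<comment> \<open>Different rows have disjoint half-edges, but \<open>(v, k)\<close> occurs in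
        both.\<close>
      then have "x = y"
        using distinct_concat_map_disjoint[of half_edges T x y] valid x y by (auto simp: valid_table_def)
      then show "e = f"
        using x y by simp
    qed
    then show "(\<forall>e\<in>edges ?G. v \<in> e \<longrightarrow> port [c e] (p v) \<in> D) \<and>
        inj_on (\<lambda>e. port [c e] (p v)) {e \<in> edges ?G. v \<in> e}"
      using port by metis
  qed
  ultimately show ?thesis
    by (auto simp: bendless_drawing_def)
qed

section \<open>Admissible edges of the two styles\<close>

lemma axis_aligned_oct_dir: "even k \<Longrightarrow> axis_aligned (of_nat n * pt (oct_dir k))"
proof -
  assume "even k"
  then have "even (k mod 8)"
    by (simp add: dvd_mod)
  then show ?thesis
    by (cases rule: mod_8_cases[of k]) (simp_all add: oct_dir_def pt_def axis_aligned_def)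
qed

lemma diagonal_oct_dir: "odd k \<Longrightarrow> diagonal (of_nat n * pt (oct_dir k))"
proof -
  assume "odd k"
  then have "odd (k mod 8)"
    by (simp add: dvd_mod_iff)
  then show ?thesis
    by (cases rule: mod_8_cases[of k]) (simp_all add: oct_dir_def pt_def diagonal_def)
qed

lemma axis_aligned_oct_cis: "axis_aligned (oct_cis (2 * a))"
  using axis_aligned_oct_dir[of "2 * a" 1] by (simp add: oct_dir_even)

fun axis_tangents :: "seg \<Rightarrow> bool" where
  "axis_tangents (Line x y k n) \<longleftrightarrow> even k"
| "axis_tangents s \<longleftrightarrow> True"

fun straight :: "seg \<Rightarrow> bool" where
  "straight (Line x y k n) \<longleftrightarrow> True"
| "straight s \<longleftrightarrow> False"

lemma line_nontrivial: "n > 0 \<Longrightarrow> of_nat n * pt (oct_dir k) \<noteq> 0"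
  using sgn_pt_oct_dir[of k] by (auto simp: oct_cis_def)

lemma axis_tangents_ports:
  assumes "axis_tangents s"
  shows "even (fst (seg_ports s))" "even (snd (seg_ports s))"
  using assms by (cases s; simp add: dvd_mod)+

lemma smooth_orthogonal_seg:
  assumes "proper_seg s" "axis_tangents s"
  shows "smooth_orthogonal_edge [seg_path s]"
proof (cases s)
  case (Line x y k n)
  then have "axis_aligned_segment (seg_path s)"
    using Line assms line_nontrivial[of n k] axis_aligned_oct_dir[of k n]
    unfolding axis_aligned_segment_def Line
    by (intro exI[of _ "pt (x, y)"] exI[of _ "pt (x, y) + of_nat n * pt (oct_dir k)"]) simp
  then show ?thesis
    by (simp add: smooth_orthogonal_edge_def)
next
  case (Quarter x y a)
  have "axis_aligned (start_dir (seg_path s))" "axis_aligned (- end_dir (seg_path s))"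
    using seg_dirs[OF assms(1)] axis_tangents_ports[OF assms(2)] axis_aligned_oct_cis by (metis evenE)+
  moreover have "\<bar>real (a + 1) * pi / 2 - real a * pi / 2\<bar> = pi / 2"
    by (simp add: field_simps)
  ultimately have "axis_aligned_arc (seg_path s)"
    unfolding axis_aligned_arc_def Quarter seg_path.simps by (intro conjI exI[of _ 1] exI) (auto simp: axis_aligned_def)
  then show ?thesis
    by (simp add: smooth_orthogonal_edge_def)
next
  case (ThreeQuarters x y a)
  have "axis_aligned (start_dir (seg_path s))" "axis_aligned (- end_dir (seg_path s))"
    using seg_dirs[OF assms(1)] axis_tangents_ports[OF assms(2)] axis_aligned_oct_cis by (metis evenE)+
  moreover have "\<bar>real (a + 3) * pi / 2 - real a * pi / 2\<bar> = 3 * pi / 2"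
    by (simp add: field_simps)
  ultimately have "axis_aligned_arc (seg_path s)"
    unfolding axis_aligned_arc_def ThreeQuarters seg_path.simps by (intro conjI exI[of _ 2] exI) (auto simp: axis_aligned_def)
  then show ?thesis
    by (simp add: smooth_orthogonal_edge_def)
qed

lemma octilinear_seg:
  assumes "proper_seg s" "straight s"
  shows "octilinear_edge [seg_path s]"
proof (cases s)
  case (Line x y k n)
  let ?b = "pt (x, y) + of_nat n * pt (oct_dir k)"
  have "axis_aligned_segment (seg_path s) \<or> diagonal_segment (seg_path s)"
  proof (cases "even k")
    case True
    then have "axis_aligned_segment (seg_path s)"
      using Line assms line_nontrivial[of n k] axis_aligned_oct_dir[of k n]
      unfolding axis_aligned_segment_def Line
      by (intro exI[of _ "pt (x, y)"] exI[of _ ?b]) simp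
    then show ?thesis ..
  next
    case False
    then have "diagonal_segment (seg_path s)"
      using Line assms line_nontrivial[of n k] diagonal_oct_dir[of k n]
      unfolding diagonal_segment_def Line
      by (intro exI[of _ "pt (x, y)"] exI[of _ ?b]) simp
    then show ?thesis ..
  qed
  then show ?thesis
    by (simp add: octilinear_edge_def)
qed (use assms in simp_all)

lemma oct_cis_octilinear_ports: "k < 8 \<Longrightarrow> oct_cis k \<in> octilinear_ports"
  by (auto simp: octilinear_ports_def oct_cis_def)

lemma oct_cis_orthogonal_ports:
  assumes "k < 8" "even k"
  shows "oct_cis k \<in> orthogonal_ports"
proof -
  obtain j where "k = 2 * j"
    using assms(2) by blast
  then have "j < 4" "oct_cis k = cis (real j * pi / 2)"
    using assms(1) by (auto simp: oct_cis_def field_simps)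
  then show ?thesis
    by (auto simp: orthogonal_ports_def)
qed

section \<open>The octagonal antiprism\<close>

text \<open>
  The vertices \<open>0..7\<close> form one octagon and \<open>8..15\<close> the other; vertex \<open>8 + i\<close> is adjacent to \<open>i\<close> and
  \<open>i + 1\<close> (mod 8). Edges are listed with the smaller endpoint first.
\<close>

definition antiprism_edges :: "(nat \<times> nat) list" where
  "antiprism_edges = concat (map (\<lambda>i. let j = (i + 1) mod 8 in
     [(min i j, max i j), (i, 8 + i), (j, 8 + i), (8 + min i j, 8 + max i j)]) [0..<8])"

definition antiprism :: "nat graph" where
  "antiprism = graph_of 16 antiprism_edges"

definition smooth_points :: "(int \<times> int) list" where
  "smooth_points =
  [(0, 0), (1, 1), (2, 2), (0, 4), (-1, 3), (-2, 2), (-3, 1), (-1, -1), (0, 1), (1, 2), (1, 3), (0, 3), (-1, 2), (-2, 1), (-2, 0), (-1, 0)]"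

text \<open>The outer octagon is two parallel staircases of three unit quarter arcs, closed by the
  three-quarter arcs \<open>2\<close>-\<open>3\<close> and \<open>6\<close>-\<open>7\<close>.
  Between \<open>2\<close> and \<open>3\<close> two quarter arcs meet at the common neighbour
  \<open>10\<close>, so these ends differ by 2 in each coordinate and the closing arc has radius 2;
  likewise for \<open>6\<close>, \<open>7\<close> and \<open>14\<close>.\<close>

definition smooth_table :: table where
  "smooth_table =
  [(0, 1, Quarter 0 1 3), (0, 8, Line 0 0 2 1), (1, 8, Line 1 1 4 1), (9, 8, Quarter 1 1 1),
   (1, 2, Quarter 1 2 3), (1, 9, Line 1 1 2 1), (2, 9, Line 2 2 4 1), (9, 10, Line 1 2 2 1),
   (2, 3, ThreeQuarters 2 4 3), (2, 10, Quarter 1 2 0), (10, 3, Quarter 0 3 0), (10, 11, Line 1 3 4 1),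
   (3, 4, Quarter 0 3 1), (3, 11, Line 0 4 6 1), (4, 11, Line (-1) 3 0 1), (12, 11, Quarter (-1) 3 3),
   (4, 5, Quarter (-1) 2 1), (4, 12, Line (-1) 3 6 1), (5, 12, Line (-2) 2 0 1), (13, 12, Quarter (-2) 2 3),
   (5, 6, Quarter (-2) 1 1), (5, 13, Line (-2) 2 6 1), (6, 13, Line (-3) 1 0 1), (13, 14, Line (-2) 1 6 1),
   (6, 7, ThreeQuarters (-3) (-1) 1), (6, 14, Quarter (-2) 1 2), (14, 7, Quarter (-1) 0 2), (14, 15, Line (-2) 0 0 1),
   (7, 0, Quarter (-1) 0 3), (7, 15, Line (-1) (-1) 2 1), (0, 15, Line 0 0 4 1), (8, 15, Quarter 0 0 1)]"

definition octilinear_points :: "(int \<times> int) list" where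
  "octilinear_points =
  [(0, 0), (2, 0), (3, 1), (3, 3), (2, 4), (0, 4), (-1, 3), (-1, 1), (1, 1), (2, 1), (2, 2), (2, 3), (1, 3), (0, 3), (0, 2), (0, 1)]"

text \<open>The inner vertices are the corners and side midpoints of a 2 by 2 square. A midpoint
  sees the ends of an outer side of length 2 along diagonals; a corner sees the ends of a diagonal
  outer side along unit axis-aligned segments.\<close>

definition octilinear_table :: table where
  "octilinear_table =
  [(0, 1, Line 0 0 0 2), (0, 8, Line 0 0 1 1), (1, 8, Line 2 0 3 1), (8, 9, Line 1 1 0 1),
   (1, 2, Line 2 0 1 1), (1, 9, Line 2 0 2 1), (2, 9, Line 3 1 4 1), (9, 10, Line 2 1 2 1),
   (2, 3, Line 3 1 2 2), (2, 10, Line 3 1 3 1), (3, 10, Line 3 3 5 1), (10, 11, Line 2 2 2 1),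
   (3, 4, Line 3 3 3 1), (3, 11, Line 3 3 4 1), (4, 11, Line 2 4 6 1), (11, 12, Line 2 3 4 1),
   (4, 5, Line 2 4 4 2), (4, 12, Line 2 4 5 1), (5, 12, Line 0 4 7 1), (12, 13, Line 1 3 4 1),
   (5, 6, Line 0 4 5 1), (5, 13, Line 0 4 6 1), (6, 13, Line (-1) 3 0 1), (13, 14, Line 0 3 6 1),
   (6, 7, Line (-1) 3 6 2), (6, 14, Line (-1) 3 7 1), (7, 14, Line (-1) 1 1 1), (14, 15, Line 0 2 6 1),
   (0, 7, Line 0 0 3 1), (7, 15, Line (-1) 1 0 1), (0, 15, Line 0 0 2 1), (8, 15, Line 1 1 4 1)]"

text \<open>Equality of the edge lists, order included, ensures that both tables draw literally the
  same graph.\<close>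

lemma smooth_table_valid:
  "valid_table smooth_points smooth_table \<and> length smooth_points = 16 \<and>
   edge_ends smooth_table = antiprism_edges \<and>
   list_all (\<lambda>(a, b, s). proper_seg s \<and> axis_tangents s) smooth_table"
  by code_simp

lemma octilinear_table_valid:
  "valid_table octilinear_points octilinear_table \<and> length octilinear_points = 16 \<and>
   edge_ends octilinear_table = antiprism_edges \<and>
   list_all (\<lambda>(a, b, s). proper_seg s \<and> straight s) octilinear_table"
  by code_simp

lemma antiprism_smooth:
  "\<exists>p c. bendless_drawing smooth_orthogonal_edge orthogonal_ports antiprism p c"
proof -
  have T: "proper_seg s" "axis_tangents s" if "(a, b, s) \<in> set smooth_table" for a b s
    using smooth_table_valid that by (auto simp: list_all_iff)
  show ?thesis
    using bendless_drawing_of_table[of smooth_points smooth_table smooth_orthogonal_edge orthogonal_ports]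
      smooth_table_valid T smooth_orthogonal_seg oct_cis_orthogonal_ports seg_ports_less axis_tangents_ports
    by (simp add: antiprism_def)
qed

lemma antiprism_octilinear:
  "\<exists>p c. bendless_drawing octilinear_edge octilinear_ports antiprism p c"
proof -
  have T: "proper_seg s" "straight s" if "(a, b, s) \<in> set octilinear_table" for a b s
    using octilinear_table_valid that by (auto simp: list_all_iff)
  show ?thesis
    using bendless_drawing_of_table[of octilinear_points octilinear_table octilinear_edge octilinear_ports]
      octilinear_table_valid T octilinear_seg oct_cis_octilinear_ports seg_ports_less
    by (simp add: antiprism_def)
qed

lemma simple_graph_antiprism: "simple_graph antiprism"
proof -
  have "list_all (\<lambda>(a, b). a < b \<and> b < 16) antiprism_edges"
    by code_simp
  then show ?thesis
    by (fastforce simp: simple_graph_def antiprism_def graph_of_def list_all_iff)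
qed

text \<open>Degrees are counted on ordered pairs; as all pairs satisfy \<open>a < b\<close>,
  forgetting the order is injective and preserves the count.\<close>

lemma regular_graph_antiprism: "regular_graph 4 antiprism"
proof -
  let ?edge = "\<lambda>(a, b). {a, b}"
  have check: "list_all (\<lambda>(a, b). a < b) antiprism_edges \<and> distinct antiprism_edges \<and>
      list_all (\<lambda>v. length (filter (\<lambda>(a, b). v = a \<or> v = b) antiprism_edges) = 4) [0..<16]"
    by code_simp
  have inj: "inj_on ?edge (set antiprism_edges)"
  proof (rule inj_on_subset)
    show "inj_on ?edge {(a :: nat, b). a < b}"
      by (auto simp: inj_on_def doubleton_eq_iff)
    show "set antiprism_edges \<subseteq> {(a, b). a < b}"
      using check by (auto simp: list_all_iff)
  qed
  have "degree_of antiprism v = 4" if "v < 16" for v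
  proof -
    let ?inc = "filter (\<lambda>(a, b). v = a \<or> v = b) antiprism_edges"
    have "{e \<in> edges antiprism. v \<in> e} = ?edge ` set ?inc"
      by (auto simp: antiprism_def graph_of_def)
    moreover have "card (?edge ` set ?inc) = card (set ?inc)"
      using inj by (intro card_image) (auto intro: inj_on_subset)
    moreover have "card (set ?inc) = length ?inc"
      using check by (intro distinct_card) simp
    moreover have "length ?inc = 4"
      using check that by (simp add: list_all_iff)
    ultimately show ?thesis
      by (simp add: degree_of_def)
  qed
  then show ?thesis
    by (simp add: regular_graph_def antiprism_def graph_of_def)
qed

section \<open>The infinite family\<close>

lemma smooth_orthogonal_drawing_of_bendless:
  assumes "bendless_drawing smooth_orthogonal_edge orthogonal_ports G p c"
  shows "smooth_orthogonal_drawing G p (\<lambda>e. [c e]) \<and> bendless G (\<lambda>e. [c e])"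
  using assms by (simp add: bendless_drawing_def smooth_orthogonal_drawing_def bendless_def)

lemma octilinear_drawing_of_bendless:
  assumes "bendless_drawing octilinear_edge octilinear_ports G p c"
  shows "octilinear_drawing G p (\<lambda>e. [c e]) \<and> bendless G (\<lambda>e. [c e])"
  using assms by (simp add: bendless_drawing_def octilinear_drawing_def bendless_def)

text \<open>The vertex number is the invariant that separates the members of the family.\<close>

lemma card_verts_isomorphic:
  "isomorphic_graphs G H \<Longrightarrow> card (verts G) = card (verts H)"
  by (auto simp: isomorphic_graphs_def bij_betw_same_card)

theorem theorem1:
  shows "\<exists>F :: nat graph set.
           infinite F \<and> pairwise (\<lambda>G H. \<not> isomorphic_graphs G H) F \<and>
           (\<forall>G\<in>F. simple_graph G \<and> regular_graph 4 G \<and> planar_graph G \<and>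
                  (\<exists>p s. smooth_orthogonal_drawing G p s \<and> bendless G s) \<and>
                  (\<exists>p s. octilinear_drawing G p s \<and> bendless G s))"
proof -
  \<comment> \<open>\<open>Suc m\<close> keeps the empty graph out of the family.\<close>
  define H where "H m = copies 16 (Suc m) antiprism" for m
  have card_H: "card (verts (H m)) = 16 * Suc m" for m
    by (simp add: H_def copies_def)
  then have "inj H"
    by (metis injI mult_left_cancel zero_neq_numeral Suc_inject)
  then have "infinite (range H)"
    using finite_imageD infinite_UNIV_nat by blast
  moreover have "pairwise (\<lambda>G H. \<not> isomorphic_graphs G H) (range H)"
    by (auto simp: pairwise_def card_H dest!: card_verts_isomorphic)
  moreover have "simple_graph (H m) \<and> regular_graph 4 (H m) \<and> planar_graph (H m) \<and>
      (\<exists>p s. smooth_orthogonal_drawing (H m) p s \<and> bendless (H m) s) \<and>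
      (\<exists>p s. octilinear_drawing (H m) p s \<and> bendless (H m) s)" for m
  proof -
    have verts: "verts antiprism = {..<16}"
      by (simp add: antiprism_def graph_of_def)
    obtain p c where smooth: "bendless_drawing smooth_orthogonal_edge orthogonal_ports (H m) p c"
      using antiprism_smooth bendless_drawing_copies[OF simple_graph_antiprism verts]
        smooth_orthogonal_edge_translation unfolding H_def by metis
    obtain p' c' where oct: "bendless_drawing octilinear_edge octilinear_ports (H m) p' c'"
      using antiprism_octilinear bendless_drawing_copies[OF simple_graph_antiprism verts]
        octilinear_edge_translation unfolding H_def by metis
    have "planar_graph (H m)"
      using smooth by (auto simp: planar_graph_def bendless_drawing_def)
    then show ?thesis
      using smooth_orthogonal_drawing_of_bendless[OF smooth] octilinear_drawing_of_bendless[OF oct]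
        simple_graph_copies[OF simple_graph_antiprism verts]
        regular_graph_copies[OF simple_graph_antiprism verts regular_graph_antiprism]
      unfolding H_def by blast
  qed
  ultimately show ?thesis
    by blast
qed

end
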